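(* For admissible angles $(\theta,\phi)$ put $\tilde a=\sin\theta(\cos\phi+\sin\phi)>0$ and, for $r>1/\tilde a$, let $$F(r,\theta,\phi)=r\sin\theta\cos\phi\,\delta+r\cos\theta\,\mu+r\sin\theta\sin\phi\,(\sigma^2+\mu^2)+\frac1n\sum_{k=1}^n\sup_{x\in\mathbb{R}}\big[(\tau-x)_+^2-r\sin\theta\cos\phi\,(x-x_k)^2-r\cos\theta\,x-r\sin\theta\sin\phi\,x^2\big].$$ The solution of the dual problem $\inf_{r,\theta,\phi}F(r,\theta,\phi)$ can be computed approximately by a grid search over admissible angles $(\theta,\phi)$ where, for each fixed $(\theta,\phi)$, a linear search over $\{r:r\tilde a>1\}$ finds the extremal point $r^*$ of $F(\cdot,\theta,\phi)$, and $F$ is minimized over the resulting list of tuples. Precisely, for each admissible $(\theta,\phi)$: either there is $r^*>1/\tilde a$ with $\partial_rF(r^* )=0$ (so $F(\cdot,\theta,\phi)$ is minimized there over $r>1/\tilde a$), or the infimum of $F(\cdot,\theta,\phi)$ over $r>1/\tilde a$ is its limit as $r\downarrow1/\tilde a$. Furthermore, the partial derivative of $F$ in $r$ is continuous and at $r=r^*$ is $$\partial_rF(r^* )=\alpha-\frac{\alpha_0}n\sum_{k=1}^nx_k^2+\frac1n\Big[\sum_{k=1}^n\beta_k-\sum_{k\in K_1}\frac{\tilde a\,C_k}{(r^*\tilde a-1)^2}\Big],$$ where $\alpha_0=\sin\theta\cos\phi$, $\alpha=\alpha_0\delta+\cos\theta\,\mu+\sin\theta\sin\phi(\sigma^2+\mu^2)$,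 $\tilde b_k=\sin\theta\cos\phi\,x_k-\frac12\cos\theta$, $\beta_k=\tilde b_k^2/\tilde a$, $C_k=(\tau-\tilde b_k/\tilde a)^2$, and $K_1=\{k:\tau-\tilde b_k/\tilde a>0\}$.
   Context: Data: $n\ge1$, real numbers $x_1,\dots,x_n$, $\tau,\mu\in\mathbb{R}$, $\sigma\ge0$, $\delta\ge0$; $Q_n=\frac1n\sum_{i=1}^n\delta_{x_i}$ is the empirical measure; $(z)_+=\max(z,0)$ and $(z)_+^2=((z)_+)^2$. Angles $\theta\in[0,\pi]$, $\phi\in[0,2\pi)$ are called admissible if $\sin\theta(\cos\phi+\sin\phi)>0$ and $\sin\theta\cos\phi\ge0$. (These are the spherical coordinates $\lambda_1=r\sin\theta\cos\phi\ge0$, $\lambda_2=r\cos\theta$, $\lambda_3=r\sin\theta\sin\phi$ for the dual variables.) $\partial_r$ denotes the derivative in $r$ with $(\theta,\phi)$ fixed. Standing assumption (interior point/Slater condition): $(\mu,\sigma^2+\mu^2,\delta)$ is an interior point of the subset of $\mathbb{R}^3$ consisting of all triples $(\mathbb{E}[U],\mathbb{E}[U^2],\mathbb{E}[(U-X)^2]+s)$, where $s\ge0$ and $(U,X)$ ranges over pairs of real random variables with $X\sim Q_n$ and $\mathbb{E}[U^2]<\infty$. *)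

theory Defs
  imports "HOL-Probability.Probability"
begin

definition admissible_angles :: "(real \<times> real) set" where
  "admissible_angles = {(\<theta>, \<phi>). 0 \<le> \<theta> \<and> \<theta> \<le> pi \<and> 0 \<le> \<phi> \<and> \<phi> < 2 * pi \<and>
     sin \<theta> * (cos \<phi> + sin \<phi>) > 0 \<and> sin \<theta> * cos \<phi> \<ge> 0}"

definition a_tilde :: "real \<Rightarrow> real \<Rightarrow> real" where
  "a_tilde \<theta> \<phi> = sin \<theta> * (cos \<phi> + sin \<phi>)"

definition alpha0 :: "real \<Rightarrow> real \<Rightarrow> real" where
  "alpha0 \<theta> \<phi> = sin \<theta> * cos \<phi>"

definition alpha :: "real \<Rightarrow> real \<Rightarrow> real \<Rightarrow> real \<Rightarrow> real \<Rightarrow> real" where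
  "alpha \<mu> \<sigma> \<delta> \<theta> \<phi> =
     alpha0 \<theta> \<phi> * \<delta> + cos \<theta> * \<mu> + sin \<theta> * sin \<phi> * (\<sigma>\<^sup>2 + \<mu>\<^sup>2)"

definition b_tilde :: "(nat \<Rightarrow> real) \<Rightarrow> real \<Rightarrow> real \<Rightarrow> nat \<Rightarrow> real" where
  "b_tilde x \<theta> \<phi> k = sin \<theta> * cos \<phi> * x k - cos \<theta> / 2"

definition beta :: "(nat \<Rightarrow> real) \<Rightarrow> real \<Rightarrow> real \<Rightarrow> nat \<Rightarrow> real" where
  "beta x \<theta> \<phi> k = (b_tilde x \<theta> \<phi> k)\<^sup>2 / a_tilde \<theta> \<phi>"

definition C_coeff :: "(nat \<Rightarrow> real) \<Rightarrow> real \<Rightarrow> real \<Rightarrow> real \<Rightarrow> nat \<Rightarrow> real" where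
  "C_coeff x \<tau> \<theta> \<phi> k = (\<tau> - b_tilde x \<theta> \<phi> k / a_tilde \<theta> \<phi>)\<^sup>2"

definition K1 :: "nat \<Rightarrow> (nat \<Rightarrow> real) \<Rightarrow> real \<Rightarrow> real \<Rightarrow> real \<Rightarrow> nat set" where
  "K1 n x \<tau> \<theta> \<phi> = {k \<in> {1..n}. \<tau> - b_tilde x \<theta> \<phi> k / a_tilde \<theta> \<phi> > 0}"

definition inner_obj :: "real \<Rightarrow> real \<Rightarrow> real \<Rightarrow> real \<Rightarrow> real \<Rightarrow> real \<Rightarrow> real" where
  "inner_obj \<tau> r \<theta> \<phi> y u = (max (\<tau> - u) 0)\<^sup>2 - r * sin \<theta> * cos \<phi> * (u - y)\<^sup>2
     - r * cos \<theta> * u - r * sin \<theta> * sin \<phi> * u\<^sup>2"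

text \<open>The supremum below is taken in the reals; it is the genuine one whenever
  \<^term>\<open>r > 1 / a_tilde \<theta> \<phi>\<close> and \<^term>\<open>a_tilde \<theta> \<phi> > 0\<close>, see \<open>bdd_above_inner_obj\<close>.\<close>

definition dual_F :: "nat \<Rightarrow> (nat \<Rightarrow> real) \<Rightarrow> real \<Rightarrow> real \<Rightarrow> real \<Rightarrow> real
    \<Rightarrow> real \<Rightarrow> real \<Rightarrow> real \<Rightarrow> real" where
  "dual_F n x \<tau> \<mu> \<sigma> \<delta> r \<theta> \<phi> =
     r * sin \<theta> * cos \<phi> * \<delta> + r * cos \<theta> * \<mu> + r * sin \<theta> * sin \<phi> * (\<sigma>\<^sup>2 + \<mu>\<^sup>2)
     + (1 / real n) * (\<Sum>k=1..n. SUP u. inner_obj \<tau> r \<theta> \<phi> (x k) u)"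

lemma bdd_above_inner_obj:
  assumes "a_tilde \<theta> \<phi> > 0" "r > 1 / a_tilde \<theta> \<phi>"
  shows "bdd_above (range (inner_obj \<tau> r \<theta> \<phi> y))"
proof -
  define d where "d = r * a_tilde \<theta> \<phi> - 1"
  define c where "c = r * sin \<theta> * cos \<phi> * y - r * cos \<theta> / 2 - \<tau>"
  have d: "d > 0" using assms by (simp add: d_def field_simps)
  have "inner_obj \<tau> r \<theta> \<phi> y u \<le> c\<^sup>2 / d + \<tau>\<^sup>2 - r * sin \<theta> * cos \<phi> * y\<^sup>2" for u
  proof -
    have "(max (\<tau> - u) 0)\<^sup>2 \<le> (\<tau> - u)\<^sup>2" by (auto simp: max_def)
    then have "inner_obj \<tau> r \<theta> \<phi> y u
        \<le> - d * u\<^sup>2 + 2 * c * u + \<tau>\<^sup>2 - r * sin \<theta> * cos \<phi> * y\<^sup>2"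
      unfolding inner_obj_def d_def c_def a_tilde_def
      by (simp add: algebra_simps power2_eq_square)
    also have "- d * u\<^sup>2 + 2 * c * u = c\<^sup>2 / d - d * (u - c / d)\<^sup>2"
      using d by (simp add: field_simps power2_eq_square)
    also have "\<dots> \<le> c\<^sup>2 / d" using d by simp
    finally show ?thesis by simp
  qed
  then show ?thesis by (intro bdd_aboveI) auto
qed

definition dual_domain :: "(real \<times> real \<times> real) set" where
  "dual_domain = {(r, \<theta>, \<phi>). (\<theta>, \<phi>) \<in> admissible_angles \<and> r > 1 / a_tilde \<theta> \<phi>}"

definition dual_value :: "nat \<Rightarrow> (nat \<Rightarrow> real) \<Rightarrow> real \<Rightarrow> real \<Rightarrow> real \<Rightarrow> real \<Rightarrow> real" where
  "dual_value n x \<tau> \<mu> \<sigma> \<delta> = (INF (r, \<theta>, \<phi>) \<in> dual_domain. dual_F n x \<tau> \<mu> \<sigma> \<delta> r \<theta> \<phi>)"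

definition extremal_points :: "nat \<Rightarrow> (nat \<Rightarrow> real) \<Rightarrow> real \<Rightarrow> real \<Rightarrow> real \<Rightarrow> real
    \<Rightarrow> real \<Rightarrow> real \<Rightarrow> real set" where
  "extremal_points n x \<tau> \<mu> \<sigma> \<delta> \<theta> \<phi> = {r. r > 1 / a_tilde \<theta> \<phi> \<and>
     ((\<lambda>r. dual_F n x \<tau> \<mu> \<sigma> \<delta> r \<theta> \<phi>) has_real_derivative 0) (at r)}"

text \<open>The number contributed by one pair of angles to the final minimisation of the grid
  search: the value of \<open>F\<close> at an extremal point if there is one, and otherwise the limit
  at the left end of the half-line.\<close>

definition line_search_value :: "nat \<Rightarrow> (nat \<Rightarrow> real) \<Rightarrow> real \<Rightarrow> real \<Rightarrow> real \<Rightarrow> real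
    \<Rightarrow> real \<Rightarrow> real \<Rightarrow> real" where
  "line_search_value n x \<tau> \<mu> \<sigma> \<delta> \<theta> \<phi> =
     (if extremal_points n x \<tau> \<mu> \<sigma> \<delta> \<theta> \<phi> \<noteq> {}
      then dual_F n x \<tau> \<mu> \<sigma> \<delta> (SOME r. r \<in> extremal_points n x \<tau> \<mu> \<sigma> \<delta> \<theta> \<phi>) \<theta> \<phi>
      else Lim (at_right (1 / a_tilde \<theta> \<phi>)) (\<lambda>r. dual_F n x \<tau> \<mu> \<sigma> \<delta> r \<theta> \<phi>))"

definition empirical_measure :: "nat \<Rightarrow> (nat \<Rightarrow> real) \<Rightarrow> real measure" where
  "empirical_measure n x = distr (uniform_count_measure {1..n}) borel x"

lemma measure_empirical_measure:
  assumes "n \<ge> 1" "A \<in> sets borel"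
  shows "measure (empirical_measure n x) A = (1 / real n) * (\<Sum>k=1..n. indicator A (x k))"
proof -
  have "measure (empirical_measure n x) A
      = measure (uniform_count_measure {1..n}) (x -` A \<inter> {1..n})"
    using assms unfolding empirical_measure_def
    by (subst measure_distr) (auto simp: space_uniform_count_measure sets_uniform_count_measure
        measurable_def)
  also have "\<dots> = real (card (x -` A \<inter> {1..n})) / real n"
    by (subst measure_uniform_count_measure) auto
  also have "real (card (x -` A \<inter> {1..n})) = (\<Sum>k=1..n. indicator A (x k))"
    by (simp add: indicator_def sum.If_cases Int_def vimage_def conj_commute)
  finally show ?thesis by simp
qed

text \<open>The sample space can be taken to be the plane with an arbitrary probability measure
  (on an arbitrary \<open>\<sigma>\<close>-algebra), since only the joint law of \<open>(U, X)\<close> matters.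
  As \<open>X\<close> has finite range and \<open>U\<close> is square integrable, all expectations below exist.\<close>

definition moment_set :: "nat \<Rightarrow> (nat \<Rightarrow> real) \<Rightarrow> (real \<times> real \<times> real) set" where
  "moment_set n x =
     {(integral\<^sup>L M U, integral\<^sup>L M (\<lambda>\<omega>. (U \<omega>)\<^sup>2), integral\<^sup>L M (\<lambda>\<omega>. (U \<omega> - X \<omega>)\<^sup>2) + s)
      | (M :: (real \<times> real) measure) U X s.
        prob_space M \<and> U \<in> borel_measurable M \<and> X \<in> borel_measurable M \<and>
        distr M borel X = empirical_measure n x \<and>
        integrable M (\<lambda>\<omega>. (U \<omega>)\<^sup>2) \<and> s \<ge> 0}"

end

theory Submission
  imports Defs
begin

text \<open>Fix admissible angles and write \<open>a\<close> for \<open>a_tilde\<close>. Every inner supremum is that of a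
  squared positive part minus a parabola with leading coefficient \<open>r a > 1\<close>, so it can be computed in
  closed form (\<open>SUP_shortfall_minus_parabola\<close>). Summing over the data points, the dual function
  on the half-line \<open>r > 1 / a\<close> becomes
  \<open>F r = r A + P (1 + 1 / (r a - 1))\<close>, where the slope \<open>A\<close> and the
  nonnegative number \<open>P\<close> depend on the angles only (\<open>dual_F_eq\<close>).
  The formula for the derivative and its continuity can be read off from this.

  The Slater condition makes \<open>A\<close> positive. The vector
  \<open>\<lambda> = (cos \<theta>, sin \<theta> sin \<phi>, sin \<theta> cos \<phi>)\<close> is a unit vector, and \<open>A\<close> is at least the amount by
  which the linear functional \<open>\<lambda>\<close> at the given moment triple exceeds its infimum over the moment
  set (\<open>moment_set_supporting_halfspace\<close>). At an interior point this amount is positive, hence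
  \<open>A > 0\<close> (\<open>asymptotic_slope_pos\<close>).

  With \<open>s = r a - 1 > 0\<close> the dual function is \<open>A / a + P + (A / a) s + P / s\<close>. By the inequality
  of arithmetic and geometric means its infimum over \<open>s\<close> is
  \<open>V = (sqrt (A / a) + sqrt P)\<^sup>2\<close>. If \<open>P > 0\<close>, it is attained at the unique zero of the
  derivative; if \<open>P = 0\<close>, the dual function is linear and strictly increasing, so that it has no
  stationary point and \<open>V\<close> is its limit at the left end. Here \<open>A > 0\<close> is essential: with \<open>A = 0 < P\<close>
  the infimum would be approached only as \<open>r\<close> tends to infinity.

  In both cases the line search returns \<open>V\<close>, and the dual value is the infimum of \<open>V\<close> over the
  admissible angles. Since \<open>V\<close> is continuous, a fixed near-minimiser of \<open>V\<close> has grid points close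
  to it at which \<open>V\<close> is nearly minimal, while no grid point can fall below the infimum. The mesh
  depends on that one near-minimiser only, which is why a noncompact set of angles does no harm
  (\<open>grid_minimum_near_infimum\<close>).\<close>


section \<open>The dual function along a ray\<close>

text \<open>The slope of the dual function as \<open>r\<close> tends to infinity. It is also the value at \<open>r = 1\<close>
  of the dual function obtained by dropping the payoff \<open>(max (\<tau> - u) 0)\<^sup>2\<close>: the pairing of the dual direction with the moment
  triple, plus the mean of the suprema of the negated quadratic forms, of which
  \<open>beta x \<theta> \<phi> k - alpha0 \<theta> \<phi> * (x k)\<^sup>2\<close> is the value at its vertex.\<close>

definition asymptotic_slope ::
    "nat \<Rightarrow> (nat \<Rightarrow> real) \<Rightarrow> real \<Rightarrow> real \<Rightarrow> real \<Rightarrow> real \<Rightarrow> real \<Rightarrow> real" where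
  "asymptotic_slope n x \<mu> \<sigma> \<delta> \<theta> \<phi> =
     alpha \<mu> \<sigma> \<delta> \<theta> \<phi> - alpha0 \<theta> \<phi> / real n * (\<Sum>k=1..n. (x k)\<^sup>2)
     + (1 / real n) * (\<Sum>k=1..n. beta x \<theta> \<phi> k)"

definition mean_sq_shortfall :: "nat \<Rightarrow> (nat \<Rightarrow> real) \<Rightarrow> real \<Rightarrow> real \<Rightarrow> real \<Rightarrow> real" where
  "mean_sq_shortfall n x \<tau> \<theta> \<phi> =
     (1 / real n) * (\<Sum>k=1..n. (max (\<tau> - b_tilde x \<theta> \<phi> k / a_tilde \<theta> \<phi>) 0)\<^sup>2)"

text \<open>If \<open>m \<ge> \<tau>\<close>, the vertex \<open>m\<close> is optimal. If \<open>m < \<tau>\<close>, the maximiser of the concave quadratic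
  \<open>(\<tau> - u)\<^sup>2 - s * (u - m)\<^sup>2\<close> lies below \<open>m\<close>, hence where the positive part is not truncated.
  The upper bound treats both cases at once, since the shortfall at \<open>u\<close> exceeds that at \<open>m\<close> by at
  most \<open>\<bar>u - m\<bar>\<close>.\<close>

lemma SUP_shortfall_minus_parabola:
  fixes \<tau> m s :: real
  assumes "s > 1"
  shows "(SUP u. (max (\<tau> - u) 0)\<^sup>2 - s * (u - m)\<^sup>2 + c) = s / (s - 1) * (max (\<tau> - m) 0)\<^sup>2 + c"
proof (rule cSup_eq_maximum)
  define u where "u = (if m < \<tau> then (s * m - \<tau>) / (s - 1) else m)"
  have "(max (\<tau> - u) 0)\<^sup>2 - s * (u - m)\<^sup>2 = s / (s - 1) * (max (\<tau> - m) 0)\<^sup>2"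
  proof (cases "m < \<tau>")
    case True
    have 1: "\<tau> - u = s * (\<tau> - m) / (s - 1)" and 2: "u - m = - (\<tau> - m) / (s - 1)"
      using True assms by (simp_all add: u_def field_simps)
    have "\<tau> - u \<ge> 0" using 1 True assms by simp
    then have "(max (\<tau> - u) 0)\<^sup>2 - s * (u - m)\<^sup>2 = (\<tau> - u)\<^sup>2 - s * (u - m)\<^sup>2" by simp
    also have "\<dots> = (s\<^sup>2 - s) / (s - 1)\<^sup>2 * (\<tau> - m)\<^sup>2"
      unfolding 1 2 by (simp only: power_divide power_mult_distrib power2_minus left_diff_distrib
          diff_divide_distrib times_divide_eq_right times_divide_eq_left)
    also have "s\<^sup>2 - s = s * (s - 1)" by (simp add: algebra_simps power2_eq_square)
    also have "s * (s - 1) / (s - 1)\<^sup>2 = s / (s - 1)"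
      using assms by (simp add: power2_eq_square)
    finally show ?thesis using True by simp
  qed (use assms in \<open>auto simp: u_def\<close>)
  then show "s / (s - 1) * (max (\<tau> - m) 0)\<^sup>2 + c
      \<in> range (\<lambda>u. (max (\<tau> - u) 0)\<^sup>2 - s * (u - m)\<^sup>2 + c)"
    by (intro image_eqI[of _ _ u]) auto
next
  fix v assume "v \<in> range (\<lambda>u. (max (\<tau> - u) 0)\<^sup>2 - s * (u - m)\<^sup>2 + c)"
  then obtain u where v: "v = (max (\<tau> - u) 0)\<^sup>2 - s * (u - m)\<^sup>2 + c" by auto
  define p where "p = max (\<tau> - m) 0"
  have "(max (\<tau> - u) 0)\<^sup>2 \<le> (p + \<bar>u - m\<bar>)\<^sup>2"
    by (rule power_mono) (auto simp: p_def)
  \<comment> \<open>Young's inequality with the weights that make the coefficient of \<open>(u - m)\<^sup>2\<close> equal to \<open>s\<close>\<close>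
  also have "\<dots> = s / (s - 1) * p\<^sup>2 + s * (u - m)\<^sup>2 - (p - (s - 1) * \<bar>u - m\<bar>)\<^sup>2 / (s - 1)"
    using assms by (simp add: power2_sum power2_diff power_mult_distrib divide_simps)
      (simp add: algebra_simps power2_eq_square)
  also have "\<dots> \<le> s / (s - 1) * p\<^sup>2 + s * (u - m)\<^sup>2"
    using assms by simp
  finally show "v \<le> s / (s - 1) * (max (\<tau> - m) 0)\<^sup>2 + c"
    by (simp add: v p_def)
qed

lemma inner_obj_complete_square:
  assumes "a_tilde \<theta> \<phi> > 0"
  shows "inner_obj \<tau> r \<theta> \<phi> (x k) u =
    (max (\<tau> - u) 0)\<^sup>2 - r * a_tilde \<theta> \<phi> * (u - b_tilde x \<theta> \<phi> k / a_tilde \<theta> \<phi>)\<^sup>2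
    + r * (beta x \<theta> \<phi> k - alpha0 \<theta> \<phi> * (x k)\<^sup>2)"
proof -
  define a where "a = a_tilde \<theta> \<phi>"
  define b where "b = b_tilde x \<theta> \<phi> k"
  have "a * (u - b / a)\<^sup>2 - b\<^sup>2 / a = a * u\<^sup>2 - 2 * b * u"
    using assms by (simp add: a_def[symmetric] field_simps power2_eq_square)
  then have "r * (a * (u - b / a)\<^sup>2 - b\<^sup>2 / a) = r * (a * u\<^sup>2 - 2 * b * u)" by simp
  moreover have "inner_obj \<tau> r \<theta> \<phi> (x k) u =
      (max (\<tau> - u) 0)\<^sup>2 - r * (a * u\<^sup>2 - 2 * b * u) - r * alpha0 \<theta> \<phi> * (x k)\<^sup>2"
    unfolding inner_obj_def a_def b_def a_tilde_def b_tilde_def alpha0_def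
    by (simp add: algebra_simps power2_eq_square)
  ultimately show ?thesis
    unfolding beta_def a_def b_def by (simp add: algebra_simps)
qed

text \<open>The explicit form of the dual function along a ray. Its only singularity, at
  \<open>r = 1 / a_tilde \<theta> \<phi>\<close>, comes from the data points with positive shortfall.\<close>

lemma dual_F_eq:
  assumes "a_tilde \<theta> \<phi> > 0" "r > 1 / a_tilde \<theta> \<phi>"
  shows "dual_F n x \<tau> \<mu> \<sigma> \<delta> r \<theta> \<phi> =
    r * asymptotic_slope n x \<mu> \<sigma> \<delta> \<theta> \<phi>
    + mean_sq_shortfall n x \<tau> \<theta> \<phi> * (1 + 1 / (r * a_tilde \<theta> \<phi> - 1))"
proof -
  define a where "a = a_tilde \<theta> \<phi>"
  define p where "p k = (max (\<tau> - b_tilde x \<theta> \<phi> k / a) 0)\<^sup>2" for k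
  have s: "r * a > 1" using assms by (simp add: a_def field_simps)
  have q: "r * a / (r * a - 1) = 1 + 1 / (r * a - 1)" using s by (simp add: field_simps)
  have "(SUP u. inner_obj \<tau> r \<theta> \<phi> (x k) u) =
      (1 + 1 / (r * a - 1)) * p k + r * (beta x \<theta> \<phi> k - alpha0 \<theta> \<phi> * (x k)\<^sup>2)" for k
    unfolding inner_obj_complete_square[OF assms(1)] p_def
    using SUP_shortfall_minus_parabola[OF s] by (simp add: a_def[symmetric] q)
  then have sup: "(\<Sum>k=1..n. SUP u. inner_obj \<tau> r \<theta> \<phi> (x k) u) =
      (1 + 1 / (r * a - 1)) * (\<Sum>k=1..n. p k)
      + r * ((\<Sum>k=1..n. beta x \<theta> \<phi> k) - alpha0 \<theta> \<phi> * (\<Sum>k=1..n. (x k)\<^sup>2))"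
    by (simp only: sum.distrib sum_distrib_left[symmetric] sum_subtractf)
  have "mean_sq_shortfall n x \<tau> \<theta> \<phi> = (1 / real n) * (\<Sum>k=1..n. p k)"
    by (simp add: mean_sq_shortfall_def p_def a_def)
  then show ?thesis
    unfolding dual_F_def sup asymptotic_slope_def alpha_def a_def[symmetric]
    by (simp add: alpha0_def algebra_simps add_divide_distrib diff_divide_distrib)
qed

lemma dual_F_has_derivative:
  assumes "a_tilde \<theta> \<phi> > 0" "r > 1 / a_tilde \<theta> \<phi>"
  shows "((\<lambda>r. dual_F n x \<tau> \<mu> \<sigma> \<delta> r \<theta> \<phi>) has_real_derivative
    asymptotic_slope n x \<mu> \<sigma> \<delta> \<theta> \<phi>
    - mean_sq_shortfall n x \<tau> \<theta> \<phi> * a_tilde \<theta> \<phi> / (r * a_tilde \<theta> \<phi> - 1)\<^sup>2) (at r)"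
proof -
  define a where "a = a_tilde \<theta> \<phi>"
  have s: "r * a - 1 \<noteq> 0" using assms by (simp add: a_def field_simps)
  show ?thesis unfolding a_def[symmetric]
  proof (rule has_field_derivative_transform_within_open[of _ _ _ "{1 / a<..}"])
    show "((\<lambda>r. r * asymptotic_slope n x \<mu> \<sigma> \<delta> \<theta> \<phi>
        + mean_sq_shortfall n x \<tau> \<theta> \<phi> * (1 + 1 / (r * a - 1))) has_real_derivative
      asymptotic_slope n x \<mu> \<sigma> \<delta> \<theta> \<phi> - mean_sq_shortfall n x \<tau> \<theta> \<phi> * a / (r * a - 1)\<^sup>2) (at r)"
      using s by (auto intro!: derivative_eq_intros simp: power2_eq_square)
  qed (use assms dual_F_eq[OF assms(1)] in \<open>auto simp: a_def\<close>)
qed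

lemma mean_sq_shortfall_K1:
  "mean_sq_shortfall n x \<tau> \<theta> \<phi> = (1 / real n) * (\<Sum>k\<in>K1 n x \<tau> \<theta> \<phi>. C_coeff x \<tau> \<theta> \<phi> k)"
proof -
  have "(\<Sum>k=1..n. (max (\<tau> - b_tilde x \<theta> \<phi> k / a_tilde \<theta> \<phi>) 0)\<^sup>2) =
      (\<Sum>k\<in>K1 n x \<tau> \<theta> \<phi>. C_coeff x \<tau> \<theta> \<phi> k)"
    by (rule sum.mono_neutral_cong_right) (auto simp: K1_def C_coeff_def max_def)
  then show ?thesis by (simp add: mean_sq_shortfall_def)
qed

lemma mean_sq_shortfall_nonneg: "mean_sq_shortfall n x \<tau> \<theta> \<phi> \<ge> 0"
  by (simp add: mean_sq_shortfall_def sum_nonneg)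

section \<open>The Slater condition makes the slope positive\<close>

lemma expectation_empirical:
  fixes g :: "real \<Rightarrow> real"
  assumes "n \<ge> 1" "X \<in> borel_measurable M" "distr M borel X = empirical_measure n x"
    and g: "g \<in> borel_measurable borel"
  shows "integrable M (\<lambda>\<omega>. g (X \<omega>))"
    and "integral\<^sup>L M (\<lambda>\<omega>. g (X \<omega>)) = (1 / real n) * (\<Sum>k=1..n. g (x k))"
proof -
  have x: "x \<in> measurable (uniform_count_measure {1..n}) borel"
    by (auto simp: measurable_def sets_uniform_count_measure space_uniform_count_measure)
  have "integrable (uniform_count_measure {1..n}) (\<lambda>k. g (x k))"
    unfolding uniform_count_measure_def by (rule integrable_point_measure_finite) simp
  then show "integrable M (\<lambda>\<omega>. g (X \<omega>))"
    using integrable_distr_eq[OF assms(2) g] integrable_distr_eq[OF x g] assms(3)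
    by (simp add: empirical_measure_def)
  have "integral\<^sup>L M (\<lambda>\<omega>. g (X \<omega>)) = integral\<^sup>L (uniform_count_measure {1..n}) (\<lambda>k. g (x k))"
    using integral_distr[OF assms(2) g] integral_distr[OF x g] assms(3)
    by (simp add: empirical_measure_def)
  also have "\<dots> = (1 / real n) * (\<Sum>k=1..n. g (x k))"
    by (subst integral_uniform_count_measure) auto
  finally show "integral\<^sup>L M (\<lambda>\<omega>. g (X \<omega>)) = (1 / real n) * (\<Sum>k=1..n. g (x k))" .
qed

text \<open>Weak duality for the dual direction of the angles: completing the square in \<open>U\<close> bounds
  the quadratic form from below by a function of \<open>X\<close> alone, whose expectation is determined by
  the empirical measure. The slack \<open>s \<ge> 0\<close> in the transport coordinate only helps, because its
  multiplier \<open>alpha0 \<theta> \<phi>\<close> is nonnegative.\<close>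

lemma moment_set_supporting_halfspace:
  assumes "n \<ge> 1" "a_tilde \<theta> \<phi> > 0" "alpha0 \<theta> \<phi> \<ge> 0"
    and "(m\<^sub>1, m\<^sub>2, d) \<in> moment_set n x"
  shows "alpha0 \<theta> \<phi> / real n * (\<Sum>k=1..n. (x k)\<^sup>2) - (1 / real n) * (\<Sum>k=1..n. beta x \<theta> \<phi> k)
    \<le> cos \<theta> * m\<^sub>1 + sin \<theta> * sin \<phi> * m\<^sub>2 + alpha0 \<theta> \<phi> * d"
proof -
  from assms(4) obtain M :: "(real \<times> real) measure" and U X s where
    M: "prob_space M" and U [measurable]: "U \<in> borel_measurable M"
    and X [measurable]: "X \<in> borel_measurable M"
    and D: "distr M borel X = empirical_measure n x"
    and U2: "integrable M (\<lambda>\<omega>. (U \<omega>)\<^sup>2)" and s: "s \<ge> 0"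
    and m: "m\<^sub>1 = integral\<^sup>L M U" "m\<^sub>2 = integral\<^sup>L M (\<lambda>\<omega>. (U \<omega>)\<^sup>2)"
      "d = integral\<^sup>L M (\<lambda>\<omega>. (U \<omega> - X \<omega>)\<^sup>2) + s"
    unfolding moment_set_def by blast
  interpret prob_space M by (rule M)
  define a where "a = a_tilde \<theta> \<phi>"
  define a0 where "a0 = alpha0 \<theta> \<phi>"
  define g where "g y = a0 * y\<^sup>2 - (a0 * y - cos \<theta> / 2)\<^sup>2 / a" for y
  have X2: "integrable M (\<lambda>\<omega>. (X \<omega>)\<^sup>2)"
    by (rule expectation_empirical(1)[OF assms(1) X D]) simp
  have gm: "g \<in> borel_measurable borel" unfolding g_def by measurable
  have gX: "integrable M (\<lambda>\<omega>. g (X \<omega>))"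
    by (rule expectation_empirical(1)[OF assms(1) X D gm])
  have U1: "integrable M U"
  proof (rule Bochner_Integration.integrable_bound)
    show "integrable M (\<lambda>\<omega>. 1 + (U \<omega>)\<^sup>2)" using U2 by simp
    have "\<bar>t\<bar> \<le> 1 + t\<^sup>2" for t :: real
      using zero_le_power2[of "\<bar>t\<bar> - 1"] by (simp add: power2_diff)
    then show "AE \<omega> in M. norm (U \<omega>) \<le> norm (1 + (U \<omega>)\<^sup>2)"
      by (intro AE_I2) (simp add: order_trans[OF _ abs_ge_self])
  qed simp
  have UX: "integrable M (\<lambda>\<omega>. (U \<omega> - X \<omega>)\<^sup>2)"
  proof (rule Bochner_Integration.integrable_bound)
    show "integrable M (\<lambda>\<omega>. 2 * (U \<omega>)\<^sup>2 + 2 * (X \<omega>)\<^sup>2)" using U2 X2 by simp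
    have "(t - y)\<^sup>2 \<le> 2 * t\<^sup>2 + 2 * y\<^sup>2" for t y :: real
      using zero_le_power2[of "t + y"] by (simp add: power2_diff power2_sum)
    then show "AE \<omega> in M. norm ((U \<omega> - X \<omega>)\<^sup>2) \<le> norm (2 * (U \<omega>)\<^sup>2 + 2 * (X \<omega>)\<^sup>2)"
      by (intro AE_I2) simp
  qed simp
  have pointwise: "g y \<le> cos \<theta> * t + sin \<theta> * sin \<phi> * t\<^sup>2 + a0 * (t - y)\<^sup>2" for t y
  proof -
    define b where "b = a0 * y - cos \<theta> / 2"
    have "a * (t - b / a)\<^sup>2 = a * t\<^sup>2 - 2 * b * t + b\<^sup>2 / a"
      using assms(2) by (simp add: a_def[symmetric] field_simps power2_eq_square)
    moreover have "a = a0 + sin \<theta> * sin \<phi>"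
      by (simp add: a_def a0_def a_tilde_def alpha0_def algebra_simps)
    then have "a * t\<^sup>2 - 2 * b * t + a0 * y\<^sup>2
        = cos \<theta> * t + sin \<theta> * sin \<phi> * t\<^sup>2 + a0 * (t - y)\<^sup>2"
      by (simp add: b_def algebra_simps power2_eq_square)
    moreover have "a * (t - b / a)\<^sup>2 \<ge> 0" using assms(2) by (simp add: a_def)
    ultimately show ?thesis by (simp add: g_def b_def[symmetric])
  qed
  have "(1 / real n) * (\<Sum>k=1..n. g (x k)) = integral\<^sup>L M (\<lambda>\<omega>. g (X \<omega>))"
    by (rule expectation_empirical(2)[OF assms(1) X D gm, symmetric])
  also have "\<dots> \<le> integral\<^sup>L M (\<lambda>\<omega>. cos \<theta> * U \<omega> + sin \<theta> * sin \<phi> * (U \<omega>)\<^sup>2 + a0 * (U \<omega> - X \<omega>)\<^sup>2)"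
    using gX U1 U2 UX pointwise by (intro integral_mono) auto
  also have "\<dots> = cos \<theta> * m\<^sub>1 + sin \<theta> * sin \<phi> * m\<^sub>2 + a0 * (d - s)"
    using U1 U2 UX by (simp add: m)
  also have "\<dots> \<le> cos \<theta> * m\<^sub>1 + sin \<theta> * sin \<phi> * m\<^sub>2 + a0 * d"
    using s assms(3) by (simp add: a0_def algebra_simps)
  also have "(1 / real n) * (\<Sum>k=1..n. g (x k)) =
      a0 / real n * (\<Sum>k=1..n. (x k)\<^sup>2) - (1 / real n) * (\<Sum>k=1..n. beta x \<theta> \<phi> k)"
    by (simp add: g_def beta_def b_tilde_def a_def a0_def alpha0_def sum_subtractf sum_distrib_left
        right_diff_distrib)
  finally show ?thesis by (simp add: a0_def)
qed

text \<open>A ball of radius \<open>e\<close> around the given triple lies in the moment set. Moving from the centre by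
  \<open>e\<close> against the unit dual direction lowers the linear functional by exactly \<open>e\<close>, so the
  supporting half-space leaves the slope at least \<open>e\<close>.\<close>

lemma asymptotic_slope_pos:
  assumes "n \<ge> 1" "(\<theta>, \<phi>) \<in> admissible_angles"
    and slater: "(\<mu>, \<sigma>\<^sup>2 + \<mu>\<^sup>2, \<delta>) \<in> interior (moment_set n x)"
  shows "asymptotic_slope n x \<mu> \<sigma> \<delta> \<theta> \<phi> > 0"
proof -
  define a2 where "a2 = sin \<theta> * sin \<phi>"
  define a0 where "a0 = alpha0 \<theta> \<phi>"
  have a: "a_tilde \<theta> \<phi> > 0" "alpha0 \<theta> \<phi> \<ge> 0"
    using assms(2) by (auto simp: admissible_angles_def a_tilde_def alpha0_def)
  obtain e where e: "e > 0" "cball (\<mu>, \<sigma>\<^sup>2 + \<mu>\<^sup>2, \<delta>) e \<subseteq> moment_set n x"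
    using slater by (auto simp: mem_interior_cball)
  have "a2\<^sup>2 + a0\<^sup>2 = (sin \<theta>)\<^sup>2 * ((sin \<phi>)\<^sup>2 + (cos \<phi>)\<^sup>2)"
    by (simp only: a2_def a0_def alpha0_def power_mult_distrib distrib_left)
  then have unit: "(cos \<theta>)\<^sup>2 + (a2\<^sup>2 + a0\<^sup>2) = 1" by simp
  have "(\<mu> - e * cos \<theta>, \<sigma>\<^sup>2 + \<mu>\<^sup>2 - e * a2, \<delta> - e * a0) \<in> cball (\<mu>, \<sigma>\<^sup>2 + \<mu>\<^sup>2, \<delta>) e"
  proof -
    have "(e * cos \<theta>)\<^sup>2 + ((e * a2)\<^sup>2 + (e * a0)\<^sup>2) = e\<^sup>2 * ((cos \<theta>)\<^sup>2 + (a2\<^sup>2 + a0\<^sup>2))"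
      by (simp add: power_mult_distrib algebra_simps)
    then show ?thesis using e(1) by (simp add: dist_Pair_Pair dist_real_def unit)
  qed
  with e(2) have "(\<mu> - e * cos \<theta>, \<sigma>\<^sup>2 + \<mu>\<^sup>2 - e * a2, \<delta> - e * a0) \<in> moment_set n x" by blast
  from moment_set_supporting_halfspace[OF assms(1) a this]
  have "e * ((cos \<theta>)\<^sup>2 + (a2\<^sup>2 + a0\<^sup>2)) \<le> asymptotic_slope n x \<mu> \<sigma> \<delta> \<theta> \<phi>"
    unfolding asymptotic_slope_def alpha_def a2_def[symmetric] a0_def[symmetric]
    by (simp add: algebra_simps power2_eq_square)
  with e(1) show ?thesis by (simp add: unit)
qed

section \<open>Minimisation along a ray\<close>

text \<open>The infimum over \<open>s > 0\<close> of \<open>(A / a) (s + 1) + P (1 + 1 / s)\<close>, where \<open>s = r a - 1\<close>.\<close>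

definition line_infimum ::
    "nat \<Rightarrow> (nat \<Rightarrow> real) \<Rightarrow> real \<Rightarrow> real \<Rightarrow> real \<Rightarrow> real \<Rightarrow> real \<Rightarrow> real \<Rightarrow> real" where
  "line_infimum n x \<tau> \<mu> \<sigma> \<delta> \<theta> \<phi> =
     (sqrt (asymptotic_slope n x \<mu> \<sigma> \<delta> \<theta> \<phi> / a_tilde \<theta> \<phi>)
      + sqrt (mean_sq_shortfall n x \<tau> \<theta> \<phi>))\<^sup>2"

text \<open>The defect in the inequality of arithmetic and geometric means, as a perfect square. It shows
  that \<open>line_infimum\<close> is a lower bound, and that this bound is attained exactly where the
  square vanishes, which is the stationarity condition.\<close>

lemma dual_F_minus_line_infimum:
  assumes "a_tilde \<theta> \<phi> > 0" "r > 1 / a_tilde \<theta> \<phi>" "asymptotic_slope n x \<mu> \<sigma> \<delta> \<theta> \<phi> \<ge> 0"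
  shows "dual_F n x \<tau> \<mu> \<sigma> \<delta> r \<theta> \<phi> - line_infimum n x \<tau> \<mu> \<sigma> \<delta> \<theta> \<phi> =
    (sqrt (asymptotic_slope n x \<mu> \<sigma> \<delta> \<theta> \<phi> / a_tilde \<theta> \<phi>) * (r * a_tilde \<theta> \<phi> - 1)
      - sqrt (mean_sq_shortfall n x \<tau> \<theta> \<phi>))\<^sup>2 / (r * a_tilde \<theta> \<phi> - 1)"
proof -
  define a where "a = a_tilde \<theta> \<phi>"
  define s where "s = r * a - 1"
  define v where "v = sqrt (asymptotic_slope n x \<mu> \<sigma> \<delta> \<theta> \<phi> / a)"
  define w where "w = sqrt (mean_sq_shortfall n x \<tau> \<theta> \<phi>)"
  have a: "a > 0" and s: "s > 0" using assms by (auto simp: a_def s_def field_simps)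
  have "v\<^sup>2 = asymptotic_slope n x \<mu> \<sigma> \<delta> \<theta> \<phi> / a"
    using assms(3) a by (simp add: v_def)
  then have "asymptotic_slope n x \<mu> \<sigma> \<delta> \<theta> \<phi> = v\<^sup>2 * a" using a by (simp add: field_simps)
  moreover have "mean_sq_shortfall n x \<tau> \<theta> \<phi> = w\<^sup>2" by (simp add: w_def mean_sq_shortfall_nonneg)
  ultimately have "dual_F n x \<tau> \<mu> \<sigma> \<delta> r \<theta> \<phi> = v\<^sup>2 * (s + 1) + w\<^sup>2 * (1 + 1 / s)"
    using dual_F_eq[OF assms(1,2)] by (simp add: a_def[symmetric] s_def)
  then have "dual_F n x \<tau> \<mu> \<sigma> \<delta> r \<theta> \<phi> - (v + w)\<^sup>2 = (v * s - w)\<^sup>2 / s"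
    using s by (simp add: field_simps power2_eq_square)
  then show ?thesis
    by (simp add: line_infimum_def v_def w_def a_def s_def)
qed

text \<open>Stationarity \<open>A = P a / s\<^sup>2\<close>, with \<open>s = r a - 1\<close>, is the vanishing of the square in the
  defect formula, so stationary points are global minimisers along the ray.\<close>

lemma extremal_points_eq:
  assumes "a_tilde \<theta> \<phi> > 0" "asymptotic_slope n x \<mu> \<sigma> \<delta> \<theta> \<phi> > 0"
  shows "extremal_points n x \<tau> \<mu> \<sigma> \<delta> \<theta> \<phi> = {r. r > 1 / a_tilde \<theta> \<phi> \<and>
    dual_F n x \<tau> \<mu> \<sigma> \<delta> r \<theta> \<phi> = line_infimum n x \<tau> \<mu> \<sigma> \<delta> \<theta> \<phi>}"
proof -
  define a where "a = a_tilde \<theta> \<phi>"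
  define A where "A = asymptotic_slope n x \<mu> \<sigma> \<delta> \<theta> \<phi>"
  define P where "P = mean_sq_shortfall n x \<tau> \<theta> \<phi>"
  have a: "a > 0" and A: "A > 0" and P: "P \<ge> 0"
    using assms by (auto simp: a_def A_def P_def mean_sq_shortfall_nonneg)
  have "((\<lambda>r. dual_F n x \<tau> \<mu> \<sigma> \<delta> r \<theta> \<phi>) has_real_derivative 0) (at r) \<longleftrightarrow>
      dual_F n x \<tau> \<mu> \<sigma> \<delta> r \<theta> \<phi> = line_infimum n x \<tau> \<mu> \<sigma> \<delta> \<theta> \<phi>" if r: "r > 1 / a" for r
  proof -
    define s where "s = r * a - 1"
    have s: "s > 0" using r a by (simp add: s_def field_simps)
    have "((\<lambda>r. dual_F n x \<tau> \<mu> \<sigma> \<delta> r \<theta> \<phi>) has_real_derivative A - P * a / s\<^sup>2) (at r)"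
      using dual_F_has_derivative[OF assms(1), of r] r by (simp add: a_def A_def P_def s_def)
    then have "((\<lambda>r. dual_F n x \<tau> \<mu> \<sigma> \<delta> r \<theta> \<phi>) has_real_derivative 0) (at r) \<longleftrightarrow>
        A - P * a / s\<^sup>2 = 0"
      by (metis DERIV_unique)
    also have "\<dots> \<longleftrightarrow> A / a * s\<^sup>2 = P" using s a by (auto simp: field_simps)
    also have "\<dots> \<longleftrightarrow> sqrt (A / a * s\<^sup>2) = sqrt P" by simp
    also have "\<dots> \<longleftrightarrow> sqrt (A / a) * s = sqrt P" using s by (simp only: real_sqrt_mult) simp
    also have "\<dots> \<longleftrightarrow> dual_F n x \<tau> \<mu> \<sigma> \<delta> r \<theta> \<phi> = line_infimum n x \<tau> \<mu> \<sigma> \<delta> \<theta> \<phi>"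
      using dual_F_minus_line_infimum[OF assms(1), of r n x \<mu> \<sigma> \<delta> \<tau>] r assms(2) s
      by (auto simp: a_def[symmetric] A_def[symmetric] P_def[symmetric] s_def[symmetric])
    finally show ?thesis .
  qed
  then show ?thesis by (auto simp: extremal_points_def a_def)
qed

lemma extremal_points_nonempty:
  assumes "a_tilde \<theta> \<phi> > 0" "asymptotic_slope n x \<mu> \<sigma> \<delta> \<theta> \<phi> > 0"
    and "mean_sq_shortfall n x \<tau> \<theta> \<phi> > 0"
  shows "extremal_points n x \<tau> \<mu> \<sigma> \<delta> \<theta> \<phi> \<noteq> {}"
proof -
  define a where "a = a_tilde \<theta> \<phi>"
  define A where "A = asymptotic_slope n x \<mu> \<sigma> \<delta> \<theta> \<phi>"
  define P where "P = mean_sq_shortfall n x \<tau> \<theta> \<phi>"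
  have pos: "a > 0" "A > 0" "P > 0" using assms by (auto simp: a_def A_def P_def)
  \<comment> \<open>the equality case of the inequality of arithmetic and geometric means\<close>
  define s where "s = sqrt P / sqrt (A / a)"
  define r where "r = (1 + s) / a"
  have s: "s > 0" and rs: "r * a - 1 = s" and r: "r > 1 / a"
    using pos by (auto simp: s_def r_def field_simps)
  have "sqrt (A / a) * s = sqrt P" using pos by (simp add: s_def)
  then have "dual_F n x \<tau> \<mu> \<sigma> \<delta> r \<theta> \<phi> = line_infimum n x \<tau> \<mu> \<sigma> \<delta> \<theta> \<phi>"
    using dual_F_minus_line_infimum[OF assms(1), of r n x \<mu> \<sigma> \<delta> \<tau>] r assms(2)
    by (simp add: a_def[symmetric] A_def[symmetric] P_def[symmetric] rs)
  then show ?thesis using extremal_points_eq[OF assms(1,2)] r by (auto simp: a_def)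
qed

text \<open>Without shortfall the dual function is linear in \<open>r\<close> and has no singularity at the left
  end of the half-line.\<close>

lemma dual_F_tendsto_line_infimum:
  assumes "a_tilde \<theta> \<phi> > 0" "asymptotic_slope n x \<mu> \<sigma> \<delta> \<theta> \<phi> > 0"
    and "mean_sq_shortfall n x \<tau> \<theta> \<phi> = 0"
  shows "((\<lambda>r. dual_F n x \<tau> \<mu> \<sigma> \<delta> r \<theta> \<phi>) \<longlongrightarrow> line_infimum n x \<tau> \<mu> \<sigma> \<delta> \<theta> \<phi>)
    (at_right (1 / a_tilde \<theta> \<phi>))"
proof (rule Lim_transform_eventually)
  have "((\<lambda>r. r * asymptotic_slope n x \<mu> \<sigma> \<delta> \<theta> \<phi>) \<longlongrightarrow>
      1 / a_tilde \<theta> \<phi> * asymptotic_slope n x \<mu> \<sigma> \<delta> \<theta> \<phi>) (at_right (1 / a_tilde \<theta> \<phi>))"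
    by (intro tendsto_intros)
  then show "((\<lambda>r. r * asymptotic_slope n x \<mu> \<sigma> \<delta> \<theta> \<phi>) \<longlongrightarrow> line_infimum n x \<tau> \<mu> \<sigma> \<delta> \<theta> \<phi>)
      (at_right (1 / a_tilde \<theta> \<phi>))"
    using assms by (simp add: line_infimum_def)
  show "\<forall>\<^sub>F r in at_right (1 / a_tilde \<theta> \<phi>).
      r * asymptotic_slope n x \<mu> \<sigma> \<delta> \<theta> \<phi> = dual_F n x \<tau> \<mu> \<sigma> \<delta> r \<theta> \<phi>"
    using dual_F_eq[OF assms(1)] assms(3) by (auto simp: eventually_at_filter)
qed

lemma line_infimum_le_dual_F:
  assumes "a_tilde \<theta> \<phi> > 0" "r > 1 / a_tilde \<theta> \<phi>" "asymptotic_slope n x \<mu> \<sigma> \<delta> \<theta> \<phi> > 0"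
  shows "line_infimum n x \<tau> \<mu> \<sigma> \<delta> \<theta> \<phi> \<le> dual_F n x \<tau> \<mu> \<sigma> \<delta> r \<theta> \<phi>"
proof -
  have "r * a_tilde \<theta> \<phi> - 1 > 0" using assms(1,2) by (simp add: field_simps)
  then have "dual_F n x \<tau> \<mu> \<sigma> \<delta> r \<theta> \<phi> - line_infimum n x \<tau> \<mu> \<sigma> \<delta> \<theta> \<phi> \<ge> 0"
    using dual_F_minus_line_infimum[OF assms(1,2), of n x \<mu> \<sigma> \<delta> \<tau>] assms(3) by simp
  then show ?thesis by simp
qed

text \<open>The lower bound is attained at a stationary point when the shortfall is positive and is the
  limit at the left end when it vanishes, so it is always sharp.\<close>

lemma line_infimum_eq_INF:
  assumes "a_tilde \<theta> \<phi> > 0" "asymptotic_slope n x \<mu> \<sigma> \<delta> \<theta> \<phi> > 0"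
  shows "(INF r\<in>{1 / a_tilde \<theta> \<phi><..}. dual_F n x \<tau> \<mu> \<sigma> \<delta> r \<theta> \<phi>) = line_infimum n x \<tau> \<mu> \<sigma> \<delta> \<theta> \<phi>"
proof (rule cInf_eq_non_empty)
  fix l assume l: "\<And>v. v \<in> (\<lambda>r. dual_F n x \<tau> \<mu> \<sigma> \<delta> r \<theta> \<phi>) ` {1 / a_tilde \<theta> \<phi><..} \<Longrightarrow> l \<le> v"
  show "l \<le> line_infimum n x \<tau> \<mu> \<sigma> \<delta> \<theta> \<phi>"
  proof (cases "mean_sq_shortfall n x \<tau> \<theta> \<phi> = 0")
    case True
    show ?thesis
      by (rule tendsto_lowerbound[OF dual_F_tendsto_line_infimum[OF assms True]])
        (auto intro!: l eventually_mono[OF eventually_at_right_less])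
  next
    case False
    then obtain r where "r \<in> extremal_points n x \<tau> \<mu> \<sigma> \<delta> \<theta> \<phi>"
      using extremal_points_nonempty[OF assms, of \<tau>] mean_sq_shortfall_nonneg[of n x \<tau> \<theta> \<phi>] by auto
    then show ?thesis using extremal_points_eq[OF assms, of \<tau>] l[OF imageI, of r] by auto
  qed
qed (use line_infimum_le_dual_F[OF assms(1) _ assms(2)] in auto)

lemma line_search_value_eq:
  assumes "a_tilde \<theta> \<phi> > 0" "asymptotic_slope n x \<mu> \<sigma> \<delta> \<theta> \<phi> > 0"
  shows "line_search_value n x \<tau> \<mu> \<sigma> \<delta> \<theta> \<phi> = line_infimum n x \<tau> \<mu> \<sigma> \<delta> \<theta> \<phi>"
proof (cases "extremal_points n x \<tau> \<mu> \<sigma> \<delta> \<theta> \<phi> = {}")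
  case True
  then have "mean_sq_shortfall n x \<tau> \<theta> \<phi> = 0"
    using extremal_points_nonempty[OF assms, of \<tau>] mean_sq_shortfall_nonneg[of n x \<tau> \<theta> \<phi>] by force
  then show ?thesis
    using True tendsto_Lim[OF _ dual_F_tendsto_line_infimum[OF assms]]
    by (simp add: line_search_value_def)
next
  case False
  then have "(SOME r. r \<in> extremal_points n x \<tau> \<mu> \<sigma> \<delta> \<theta> \<phi>) \<in> extremal_points n x \<tau> \<mu> \<sigma> \<delta> \<theta> \<phi>"
    by (auto intro: someI)
  with False show ?thesis
    using extremal_points_eq[OF assms, of \<tau>] by (simp add: line_search_value_def)
qed

section \<open>Minimisation over the angles\<close>

lemma admissible_a_tilde: "(\<theta>, \<phi>) \<in> admissible_angles \<Longrightarrow> a_tilde \<theta> \<phi> > 0"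
  by (simp add: admissible_angles_def a_tilde_def)

lemma admissible_nonempty: "(pi / 2, 0) \<in> admissible_angles"
  by (simp add: admissible_angles_def)

lemma continuous_on_a_tilde:
  fixes f g :: "'a::t2_space \<Rightarrow> real"
  assumes "continuous_on S f" "continuous_on S g"
  shows "continuous_on S (\<lambda>p. a_tilde (f p) (g p))"
  unfolding a_tilde_def by (intro continuous_intros assms)

lemma continuous_on_asymptotic_slope:
  fixes f g :: "'a::t2_space \<Rightarrow> real"
  assumes "continuous_on S f" "continuous_on S g" "\<And>p. p \<in> S \<Longrightarrow> a_tilde (f p) (g p) \<noteq> 0"
  shows "continuous_on S (\<lambda>p. asymptotic_slope n x \<mu> \<sigma> \<delta> (f p) (g p))"
  unfolding asymptotic_slope_def alpha_def alpha0_def beta_def b_tilde_def divide_inverse[of _ "real n"]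
  by (intro continuous_intros continuous_on_a_tilde assms) (use assms(3) in auto)

lemma continuous_on_mean_sq_shortfall:
  fixes f g :: "'a::t2_space \<Rightarrow> real"
  assumes "continuous_on S f" "continuous_on S g" "\<And>p. p \<in> S \<Longrightarrow> a_tilde (f p) (g p) \<noteq> 0"
  shows "continuous_on S (\<lambda>p. mean_sq_shortfall n x \<tau> (f p) (g p))"
  unfolding mean_sq_shortfall_def b_tilde_def divide_inverse[of _ "real n"]
  by (intro continuous_intros continuous_on_a_tilde assms) (use assms(3) in auto)

lemma continuous_on_line_infimum:
  "continuous_on admissible_angles (\<lambda>p. line_infimum n x \<tau> \<mu> \<sigma> \<delta> (fst p) (snd p))"
proof -
  have "a_tilde (fst p) (snd p) \<noteq> 0" if "p \<in> admissible_angles" for p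
    using admissible_a_tilde[of "fst p" "snd p"] that by simp
  then show ?thesis unfolding line_infimum_def
    by (intro continuous_intros continuous_on_a_tilde continuous_on_asymptotic_slope
        continuous_on_mean_sq_shortfall) auto
qed

lemma dual_value_eq_INF_line_infimum:
  assumes "\<And>\<theta> \<phi>. (\<theta>, \<phi>) \<in> admissible_angles \<Longrightarrow> asymptotic_slope n x \<mu> \<sigma> \<delta> \<theta> \<phi> > 0"
  shows "dual_value n x \<tau> \<mu> \<sigma> \<delta> =
    (INF p\<in>admissible_angles. line_infimum n x \<tau> \<mu> \<sigma> \<delta> (fst p) (snd p))"
    (is "_ = Inf (?V ` _)")
proof -
  have bdd: "bdd_below (?V ` admissible_angles)"
    by (rule bdd_belowI[of _ 0]) (auto simp: line_infimum_def)
  show ?thesis unfolding dual_value_def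
  proof (rule cInf_eq_non_empty)
    have "(2, pi / 2, 0) \<in> dual_domain"
      using admissible_nonempty by (simp add: dual_domain_def a_tilde_def)
    then show "(\<lambda>(r, \<theta>, \<phi>). dual_F n x \<tau> \<mu> \<sigma> \<delta> r \<theta> \<phi>) ` dual_domain \<noteq> {}" by auto
  next
    fix v assume "v \<in> (\<lambda>(r, \<theta>, \<phi>). dual_F n x \<tau> \<mu> \<sigma> \<delta> r \<theta> \<phi>) ` dual_domain"
    then obtain r \<theta> \<phi> where v: "v = dual_F n x \<tau> \<mu> \<sigma> \<delta> r \<theta> \<phi>"
      and adm: "(\<theta>, \<phi>) \<in> admissible_angles" and r: "r > 1 / a_tilde \<theta> \<phi>"
      by (auto simp: dual_domain_def)
    have "Inf (?V ` admissible_angles) \<le> ?V (\<theta>, \<phi>)" using adm bdd by (rule cINF_lower[rotated])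
    also have "\<dots> \<le> v"
      using line_infimum_le_dual_F[OF admissible_a_tilde[OF adm] r assms[OF adm]] by (simp add: v)
    finally show "Inf (?V ` admissible_angles) \<le> v" .
  next
    fix l assume l: "\<And>v. v \<in> (\<lambda>(r, \<theta>, \<phi>). dual_F n x \<tau> \<mu> \<sigma> \<delta> r \<theta> \<phi>) ` dual_domain \<Longrightarrow> l \<le> v"
    show "l \<le> Inf (?V ` admissible_angles)"
    proof (rule cINF_greatest)
      fix p assume p: "p \<in> admissible_angles"
      obtain \<theta> \<phi> where eq: "p = (\<theta>, \<phi>)" by (cases p)
      have "l \<le> (INF r\<in>{1 / a_tilde \<theta> \<phi><..}. dual_F n x \<tau> \<mu> \<sigma> \<delta> r \<theta> \<phi>)"
      proof (rule cINF_greatest)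
        fix r assume "r \<in> {1 / a_tilde \<theta> \<phi><..}"
        then have "(r, \<theta>, \<phi>) \<in> dual_domain" using p eq by (simp add: dual_domain_def)
        then show "l \<le> dual_F n x \<tau> \<mu> \<sigma> \<delta> r \<theta> \<phi>" by (intro l) force
      qed simp
      then show "l \<le> ?V p"
        using line_infimum_eq_INF[OF admissible_a_tilde assms, of \<theta> \<phi>] p eq by simp
    qed (use admissible_nonempty in auto)
  qed
qed

text \<open>Only one point of \<open>S\<close> matters: the mesh \<open>\<eta>\<close> is chosen from the continuity of \<open>V\<close> at a
  single \<open>\<epsilon> / 2\<close>-minimiser. The grid is
  nonempty because it has a point near that minimiser.\<close>

lemma grid_minimum_near_infimum:
  fixes V :: "'a::metric_space \<Rightarrow> real"
  assumes "continuous_on S V" "bdd_below (V ` S)" "S \<noteq> {}" "\<epsilon> > 0"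
  shows "\<exists>\<eta>>0. \<forall>G. finite G \<and> G \<subseteq> S \<and> (\<forall>p\<in>S. \<exists>q\<in>G. dist p q < \<eta>) \<longrightarrow>
    \<bar>Min (V ` G) - Inf (V ` S)\<bar> < \<epsilon>"
proof -
  have "Inf (V ` S) < Inf (V ` S) + \<epsilon> / 2" using assms(4) by simp
  then obtain p where p: "p \<in> S" "V p < Inf (V ` S) + \<epsilon> / 2"
    using cInf_lessD[of "V ` S"] assms(3) by blast
  from assms(1,4) p(1) obtain \<eta> where \<eta>: "\<eta> > 0"
    "\<And>q. q \<in> S \<Longrightarrow> dist q p < \<eta> \<Longrightarrow> dist (V q) (V p) < \<epsilon> / 2"
    unfolding continuous_on_iff by (metis half_gt_zero)
  have "\<bar>Min (V ` G) - Inf (V ` S)\<bar> < \<epsilon>"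
    if G: "finite G" "G \<subseteq> S" "\<forall>p\<in>S. \<exists>q\<in>G. dist p q < \<eta>" for G
  proof -
    obtain q where q: "q \<in> G" "dist q p < \<eta>" using G(3) p(1) by (metis dist_commute)
    have "Min (V ` G) \<le> V q" using q(1) G(1) by simp
    also have "V q < Inf (V ` S) + \<epsilon>"
      using \<eta>(2)[OF subsetD[OF G(2) q(1)] q(2)] p(2) by (simp only: dist_real_def)
    finally have "Min (V ` G) < Inf (V ` S) + \<epsilon>" .
    moreover have "Min (V ` G) \<in> V ` G" using G(1) q(1) by (intro Min_in) auto
    then have "Inf (V ` S) \<le> Min (V ` G)" using G(2) by (intro cInf_lower assms(2)) blast
    ultimately show ?thesis using assms(4) by simp
  qed
  with \<eta>(1) show ?thesis by blast
qed

theorem proposition3p5: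
  fixes n :: nat and x :: "nat \<Rightarrow> real" and \<tau> \<mu> \<sigma> \<delta> :: real
  assumes "n \<ge> 1" and "\<sigma> \<ge> 0" and "\<delta> \<ge> 0"
    and slater: "(\<mu>, \<sigma>\<^sup>2 + \<mu>\<^sup>2, \<delta>) \<in> interior (moment_set n x)"
  shows
    "(bdd_below ((\<lambda>(r, \<theta>, \<phi>). dual_F n x \<tau> \<mu> \<sigma> \<delta> r \<theta> \<phi>) ` dual_domain) \<and>
     (\<forall>\<epsilon>>0. \<exists>\<eta>>0. \<forall>G. finite G \<and> G \<subseteq> admissible_angles \<and>
        (\<forall>p\<in>admissible_angles. \<exists>q\<in>G. dist p q < \<eta>) \<longrightarrow>
        \<bar>Min ((\<lambda>(\<theta>, \<phi>). line_search_value n x \<tau> \<mu> \<sigma> \<delta> \<theta> \<phi>) ` G)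
           - dual_value n x \<tau> \<mu> \<sigma> \<delta>\<bar> < \<epsilon>)) \<and>
     (\<forall>(\<theta>, \<phi>)\<in>admissible_angles. \<forall>r\<^sub>0\<in>extremal_points n x \<tau> \<mu> \<sigma> \<delta> \<theta> \<phi>.
        \<forall>r>1 / a_tilde \<theta> \<phi>. dual_F n x \<tau> \<mu> \<sigma> \<delta> r\<^sub>0 \<theta> \<phi> \<le> dual_F n x \<tau> \<mu> \<sigma> \<delta> r \<theta> \<phi>) \<and>
     (\<forall>(\<theta>, \<phi>)\<in>admissible_angles.
        extremal_points n x \<tau> \<mu> \<sigma> \<delta> \<theta> \<phi> \<noteq> {} \<or>
        (bdd_below ((\<lambda>r. dual_F n x \<tau> \<mu> \<sigma> \<delta> r \<theta> \<phi>) ` {1 / a_tilde \<theta> \<phi><..}) \<and>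
         ((\<lambda>r. dual_F n x \<tau> \<mu> \<sigma> \<delta> r \<theta> \<phi>) \<longlongrightarrow>
            (INF r\<in>{1 / a_tilde \<theta> \<phi><..}. dual_F n x \<tau> \<mu> \<sigma> \<delta> r \<theta> \<phi>))
           (at_right (1 / a_tilde \<theta> \<phi>)))) \<and>
     (continuous_on dual_domain
        (\<lambda>(r, \<theta>, \<phi>). deriv (\<lambda>r. dual_F n x \<tau> \<mu> \<sigma> \<delta> r \<theta> \<phi>) r)) \<and>
     (\<forall>(r, \<theta>, \<phi>)\<in>dual_domain.
        ((\<lambda>r. dual_F n x \<tau> \<mu> \<sigma> \<delta> r \<theta> \<phi>) has_real_derivative
          alpha \<mu> \<sigma> \<delta> \<theta> \<phi> - alpha0 \<theta> \<phi> / real n * (\<Sum>k=1..n. (x k)\<^sup>2)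
          + (1 / real n) * ((\<Sum>k=1..n. beta x \<theta> \<phi> k)
              - (\<Sum>k\<in>K1 n x \<tau> \<theta> \<phi>.
                   a_tilde \<theta> \<phi> * C_coeff x \<tau> \<theta> \<phi> k / (r * a_tilde \<theta> \<phi> - 1)\<^sup>2))) (at r))"
proof (intro conjI)
  let ?V = "\<lambda>p. line_infimum n x \<tau> \<mu> \<sigma> \<delta> (fst p) (snd p)"
  have a: "a_tilde \<theta> \<phi> > 0" if "(\<theta>, \<phi>) \<in> admissible_angles" for \<theta> \<phi>
    using that by (rule admissible_a_tilde)
  have A: "asymptotic_slope n x \<mu> \<sigma> \<delta> \<theta> \<phi> > 0" if "(\<theta>, \<phi>) \<in> admissible_angles" for \<theta> \<phi>
    using asymptotic_slope_pos[OF assms(1) that slater] .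
  have F_ge: "line_infimum n x \<tau> \<mu> \<sigma> \<delta> \<theta> \<phi> \<le> dual_F n x \<tau> \<mu> \<sigma> \<delta> r \<theta> \<phi>"
    if "(\<theta>, \<phi>) \<in> admissible_angles" "r > 1 / a_tilde \<theta> \<phi>" for r \<theta> \<phi>
    using line_infimum_le_dual_F[OF a[OF that(1)] that(2) A[OF that(1)]] .
  have deriv: "((\<lambda>r. dual_F n x \<tau> \<mu> \<sigma> \<delta> r \<theta> \<phi>) has_real_derivative
      asymptotic_slope n x \<mu> \<sigma> \<delta> \<theta> \<phi>
      - mean_sq_shortfall n x \<tau> \<theta> \<phi> * a_tilde \<theta> \<phi> / (r * a_tilde \<theta> \<phi> - 1)\<^sup>2) (at r)"
    if "(r, \<theta>, \<phi>) \<in> dual_domain" for r \<theta> \<phi>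
    using that by (intro dual_F_has_derivative) (auto simp: dual_domain_def a)
  have nonneg: "?V p \<ge> 0" for p by (simp add: line_infimum_def)

  have "0 \<le> dual_F n x \<tau> \<mu> \<sigma> \<delta> r \<theta> \<phi>" if "(r, \<theta>, \<phi>) \<in> dual_domain" for r \<theta> \<phi>
    using that order_trans[OF nonneg[of "(\<theta>, \<phi>)"]] F_ge[of \<theta> \<phi> r] by (simp add: dual_domain_def)
  then show "bdd_below ((\<lambda>(r, \<theta>, \<phi>). dual_F n x \<tau> \<mu> \<sigma> \<delta> r \<theta> \<phi>) ` dual_domain)"
    by (intro bdd_belowI[of _ 0]) auto

  show "\<forall>\<epsilon>>0. \<exists>\<eta>>0. \<forall>G. finite G \<and> G \<subseteq> admissible_angles \<and>
      (\<forall>p\<in>admissible_angles. \<exists>q\<in>G. dist p q < \<eta>) \<longrightarrow>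
      \<bar>Min ((\<lambda>(\<theta>, \<phi>). line_search_value n x \<tau> \<mu> \<sigma> \<delta> \<theta> \<phi>) ` G)
         - dual_value n x \<tau> \<mu> \<sigma> \<delta>\<bar> < \<epsilon>"
  proof (intro allI impI)
    fix \<epsilon> :: real assume "\<epsilon> > 0"
    have bdd: "bdd_below (?V ` admissible_angles)"
      by (rule bdd_belowI[of _ 0]) (use nonneg in auto)
    have nonempty: "admissible_angles \<noteq> {}" using admissible_nonempty by blast
    obtain \<eta> where \<eta>: "\<eta> > 0" "\<forall>G. finite G \<and> G \<subseteq> admissible_angles \<and>
        (\<forall>p\<in>admissible_angles. \<exists>q\<in>G. dist p q < \<eta>) \<longrightarrow>
        \<bar>Min (?V ` G) - Inf (?V ` admissible_angles)\<bar> < \<epsilon>"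
      using grid_minimum_near_infimum[OF continuous_on_line_infimum bdd nonempty \<open>\<epsilon> > 0\<close>]
      by (elim exE conjE) (rule that)
    have image_eq: "(\<lambda>(\<theta>, \<phi>). line_search_value n x \<tau> \<mu> \<sigma> \<delta> \<theta> \<phi>) ` G = ?V ` G"
      if "G \<subseteq> admissible_angles" for G
      using that line_search_value_eq[OF a A] by (intro image_cong) auto
    show "\<exists>\<eta>>0. \<forall>G. finite G \<and> G \<subseteq> admissible_angles \<and>
        (\<forall>p\<in>admissible_angles. \<exists>q\<in>G. dist p q < \<eta>) \<longrightarrow>
        \<bar>Min ((\<lambda>(\<theta>, \<phi>). line_search_value n x \<tau> \<mu> \<sigma> \<delta> \<theta> \<phi>) ` G)
           - dual_value n x \<tau> \<mu> \<sigma> \<delta>\<bar> < \<epsilon>"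
      using \<eta> image_eq dual_value_eq_INF_line_infimum[of n x \<mu> \<sigma> \<delta> \<tau>, OF A]
      by (intro exI[of _ \<eta>] conjI allI impI) simp_all
  qed

  show "\<forall>(\<theta>, \<phi>)\<in>admissible_angles. \<forall>r\<^sub>0\<in>extremal_points n x \<tau> \<mu> \<sigma> \<delta> \<theta> \<phi>.
      \<forall>r>1 / a_tilde \<theta> \<phi>. dual_F n x \<tau> \<mu> \<sigma> \<delta> r\<^sub>0 \<theta> \<phi> \<le> dual_F n x \<tau> \<mu> \<sigma> \<delta> r \<theta> \<phi>"
  proof (intro ballI, clarify)
    fix \<theta> \<phi> r\<^sub>0 r assume adm: "(\<theta>, \<phi>) \<in> admissible_angles"
      and "r\<^sub>0 \<in> extremal_points n x \<tau> \<mu> \<sigma> \<delta> \<theta> \<phi>" "r > 1 / a_tilde \<theta> \<phi>"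
    then show "dual_F n x \<tau> \<mu> \<sigma> \<delta> r\<^sub>0 \<theta> \<phi> \<le> dual_F n x \<tau> \<mu> \<sigma> \<delta> r \<theta> \<phi>"
      using F_ge[OF adm, of r] extremal_points_eq[OF a[OF adm] A[OF adm]] by simp
  qed

  show "\<forall>(\<theta>, \<phi>)\<in>admissible_angles.
      extremal_points n x \<tau> \<mu> \<sigma> \<delta> \<theta> \<phi> \<noteq> {} \<or>
      (bdd_below ((\<lambda>r. dual_F n x \<tau> \<mu> \<sigma> \<delta> r \<theta> \<phi>) ` {1 / a_tilde \<theta> \<phi><..}) \<and>
       ((\<lambda>r. dual_F n x \<tau> \<mu> \<sigma> \<delta> r \<theta> \<phi>) \<longlongrightarrow>
          (INF r\<in>{1 / a_tilde \<theta> \<phi><..}. dual_F n x \<tau> \<mu> \<sigma> \<delta> r \<theta> \<phi>))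
         (at_right (1 / a_tilde \<theta> \<phi>)))"
  proof (intro ballI, clarify)
    fix \<theta> \<phi> assume adm: "(\<theta>, \<phi>) \<in> admissible_angles"
      and none: "\<not> (bdd_below ((\<lambda>r. dual_F n x \<tau> \<mu> \<sigma> \<delta> r \<theta> \<phi>) ` {1 / a_tilde \<theta> \<phi><..}) \<and>
       ((\<lambda>r. dual_F n x \<tau> \<mu> \<sigma> \<delta> r \<theta> \<phi>) \<longlongrightarrow>
          (INF r\<in>{1 / a_tilde \<theta> \<phi><..}. dual_F n x \<tau> \<mu> \<sigma> \<delta> r \<theta> \<phi>))
         (at_right (1 / a_tilde \<theta> \<phi>)))"
      and empty: "extremal_points n x \<tau> \<mu> \<sigma> \<delta> \<theta> \<phi> = {}"
    have "bdd_below ((\<lambda>r. dual_F n x \<tau> \<mu> \<sigma> \<delta> r \<theta> \<phi>) ` {1 / a_tilde \<theta> \<phi><..})"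
      by (rule bdd_belowI[of _ "line_infimum n x \<tau> \<mu> \<sigma> \<delta> \<theta> \<phi>"]) (use F_ge[OF adm] in auto)
    moreover have "mean_sq_shortfall n x \<tau> \<theta> \<phi> = 0"
      using extremal_points_nonempty[OF a[OF adm] A[OF adm], of \<tau>] empty
        mean_sq_shortfall_nonneg[of n x \<tau> \<theta> \<phi>] by force
    from dual_F_tendsto_line_infimum[OF a[OF adm] A[OF adm] this]
    have "((\<lambda>r. dual_F n x \<tau> \<mu> \<sigma> \<delta> r \<theta> \<phi>) \<longlongrightarrow>
          (INF r\<in>{1 / a_tilde \<theta> \<phi><..}. dual_F n x \<tau> \<mu> \<sigma> \<delta> r \<theta> \<phi>))
         (at_right (1 / a_tilde \<theta> \<phi>))"
      by (simp only: line_infimum_eq_INF[OF a[OF adm] A[OF adm]])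
    ultimately show False using none by blast
  qed

  show "continuous_on dual_domain (\<lambda>(r, \<theta>, \<phi>). deriv (\<lambda>r. dual_F n x \<tau> \<mu> \<sigma> \<delta> r \<theta> \<phi>) r)"
  proof -
    have pos: "a_tilde (fst (snd p)) (snd (snd p)) \<noteq> 0"
        "fst p * a_tilde (fst (snd p)) (snd (snd p)) - 1 \<noteq> 0" if "p \<in> dual_domain" for p
      using that a[of "fst (snd p)" "snd (snd p)"]
      by (auto simp: dual_domain_def field_simps split: prod.splits)
    have "continuous_on dual_domain (\<lambda>p.
        asymptotic_slope n x \<mu> \<sigma> \<delta> (fst (snd p)) (snd (snd p))
        - mean_sq_shortfall n x \<tau> (fst (snd p)) (snd (snd p)) * a_tilde (fst (snd p)) (snd (snd p))
          / (fst p * a_tilde (fst (snd p)) (snd (snd p)) - 1)\<^sup>2)"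
      by (intro continuous_intros continuous_on_a_tilde continuous_on_asymptotic_slope
          continuous_on_mean_sq_shortfall) (use pos in auto)
    then show ?thesis
      by (rule continuous_on_eq) (use DERIV_imp_deriv[OF deriv] in auto)
  qed

  have formula: "asymptotic_slope n x \<mu> \<sigma> \<delta> \<theta> \<phi>
      - mean_sq_shortfall n x \<tau> \<theta> \<phi> * a_tilde \<theta> \<phi> / (r * a_tilde \<theta> \<phi> - 1)\<^sup>2 =
      alpha \<mu> \<sigma> \<delta> \<theta> \<phi> - alpha0 \<theta> \<phi> / real n * (\<Sum>k=1..n. (x k)\<^sup>2)
      + (1 / real n) * ((\<Sum>k=1..n. beta x \<theta> \<phi> k)
          - (\<Sum>k\<in>K1 n x \<tau> \<theta> \<phi>.
               a_tilde \<theta> \<phi> * C_coeff x \<tau> \<theta> \<phi> k / (r * a_tilde \<theta> \<phi> - 1)\<^sup>2))" for r \<theta> \<phi>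
    unfolding asymptotic_slope_def mean_sq_shortfall_K1
    by (simp only: sum_divide_distrib[symmetric] sum_distrib_left[symmetric])
      (simp add: algebra_simps)
  show "\<forall>(r, \<theta>, \<phi>)\<in>dual_domain.
      ((\<lambda>r. dual_F n x \<tau> \<mu> \<sigma> \<delta> r \<theta> \<phi>) has_real_derivative
        alpha \<mu> \<sigma> \<delta> \<theta> \<phi> - alpha0 \<theta> \<phi> / real n * (\<Sum>k=1..n. (x k)\<^sup>2)
        + (1 / real n) * ((\<Sum>k=1..n. beta x \<theta> \<phi> k)
            - (\<Sum>k\<in>K1 n x \<tau> \<theta> \<phi>.
                 a_tilde \<theta> \<phi> * C_coeff x \<tau> \<theta> \<phi> k / (r * a_tilde \<theta> \<phi> - 1)\<^sup>2))) (at r)"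
    using deriv unfolding formula by blast
qed

end
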